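(* Let $X,Y,Z_1,Z_2$ be random variables such that $X,Y,Z_1$ are independent, $X,Y,Z_2$ are independent, and $Z_1,Z_2$ are countermonotonic. Put $U=\max\{X,Z_1\}$ and $V=\max\{Y,Z_2\}$. Let $\widehat f$ and $\widehat g$ be the auxiliary functions associated with $(F_X,F_U)$ and $(F_Y,F_V)$ respectively, as defined in the context, and put $f(u)=\widehat f(u)-u$ and $g(v)=\widehat g(v)-v$ for $u,v\in[0,1]$. Then a copula of the pair $(U,V)$ is the RMM copula with generating functions $f$ and $g$, \[C(u,v)=\max\{0,\,uv-f(u)g(v)\},\qquad (u,v)\in[0,1]^2.\] That is, $f$ and $g$ are generating functions of an RMM copula, and $\mathbb{P}[U\le x,V\le y]=C(F_U(x),F_V(y))$ for all $x,y\in\mathbb{R}$.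
   Context: $F_W$ denotes the distribution function $F_W(x)=\mathbb{P}[W\le x]$, and $G_i$ that of $Z_i$. $Z_1,Z_2$ are countermonotonic if $\mathbb{P}[Z_1\le x,Z_2\le y]=\max\{0,G_1(x)+G_2(y)-1\}$ for all $x,y$. A copula is a function $C:[0,1]^2\to[0,1]$ with $C(x,0)=C(0,x)=0$ and $C(x,1)=C(1,x)=x$ for all $x\in[0,1]$, and $C(x_2,y_2)-C(x_1,y_2)-C(x_2,y_1)+C(x_1,y_1)\ge 0$ whenever $x_1\le x_2$, $y_1\le y_2$. A copula $C$ is a copula of $(U,V)$ if the joint distribution function of $(U,V)$ equals $C(F_U(x),F_V(y))$. An RMM (reflected maxmin) copula is a function $C(u,v)=\max\{0,uv-f(u)g(v)\}$ on $[0,1]^2$, where the generating functions $f,g:[0,1]\to[0,1]$ satisfy: (G1) $f(0)=g(0)=0$ and $f(1)=g(1)=0$; (G2) $u\mapsto f(u)+u$ and $u\mapsto g(u)+u$ are nondecreasing on $[0,1]$; (G3) $f^*(u)=f(u)/u$ and $g^*(u)=g(u)/u$ are nonincreasing on $(0,1]$. For a distribution function $F$ and $u\in[0,1]$, $F^{-1}(u)=\inf\{x\in\mathbb{R}:F(x)\ge u\}$, with $\inf\emptyset=+\infty$ and $\inf\mathbb{R}=-\infty$. Left limits are written $f(x-)$. For $u\notin\mathrm{im}\,F\cup\{0,1\}$ put $\overline u=F(F^{-1}(u))$ and $\underline u=F(F^{-1}(u)-)$. The function $\widehat f$ associated with $(F_X,F_U)$ is defined, using $F=F_U$ for $\overline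 u,\underline u$, by $\widehat f(0)=0$, $\widehat f(1)=1$, $\widehat f(u)=F_X(F_U^{-1}(u))$ for $u\in\mathrm{im}\,F_U\setminus\{0,1\}$, and for all other $u$ \[\widehat f(u)=\frac{\widehat f(\overline u)-\widehat f(\underline u-)}{\overline u-\underline u}(u-\underline u)+\widehat f(\underline u-).\] Here $\widehat f(\underline u-)$ is the left limit of $\widehat f$ at $\underline u$ when $\underline u>0$ (this is the number $F_X(F_U^{-1}(u)-)$), and $\widehat f(0-):=0$. The function $\widehat g$ is defined in the same way from $(F_Y,F_V)$. *)

theory Defs
  imports "HOL-Probability.Probability"
begin

definition copula :: "(real \<Rightarrow> real \<Rightarrow> real) \<Rightarrow> bool" where
  "copula C \<longleftrightarrow>
     (\<forall>x\<in>{0..1}. \<forall>y\<in>{0..1}. C x y \<in> {0..1}) \<and>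
     (\<forall>x\<in>{0..1}. C x 0 = 0 \<and> C 0 x = 0 \<and> C x 1 = x \<and> C 1 x = x) \<and>
     (\<forall>x1\<in>{0..1}. \<forall>x2\<in>{0..1}. \<forall>y1\<in>{0..1}. \<forall>y2\<in>{0..1}.
        x1 \<le> x2 \<longrightarrow> y1 \<le> y2 \<longrightarrow> C x2 y2 - C x1 y2 - C x2 y1 + C x1 y1 \<ge> 0)"

definition dist_fun :: "'a measure \<Rightarrow> ('a \<Rightarrow> real) \<Rightarrow> real \<Rightarrow> real" where
  "dist_fun M W = cdf (distr M borel W)"

definition joint_dist_fun ::
  "'a measure \<Rightarrow> ('a \<Rightarrow> real) \<Rightarrow> ('a \<Rightarrow> real) \<Rightarrow> real \<Rightarrow> real \<Rightarrow> real" where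
  "joint_dist_fun M V W x y = measure M {\<omega> \<in> space M. V \<omega> \<le> x \<and> W \<omega> \<le> y}"

definition copula_of ::
  "'a measure \<Rightarrow> ('a \<Rightarrow> real) \<Rightarrow> ('a \<Rightarrow> real) \<Rightarrow> (real \<Rightarrow> real \<Rightarrow> real) \<Rightarrow> bool" where
  "copula_of M U V C \<longleftrightarrow> copula C \<and>
     (\<forall>x y. joint_dist_fun M U V x y = C (dist_fun M U x) (dist_fun M V y))"

definition countermonotonic :: "'a measure \<Rightarrow> ('a \<Rightarrow> real) \<Rightarrow> ('a \<Rightarrow> real) \<Rightarrow> bool" where
  "countermonotonic M Z1 Z2 \<longleftrightarrow>
     (\<forall>x y. joint_dist_fun M Z1 Z2 x y = max 0 (dist_fun M Z1 x + dist_fun M Z2 y - 1))"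

definition rmm_generator :: "(real \<Rightarrow> real) \<Rightarrow> bool" where
  "rmm_generator f \<longleftrightarrow>
     f \<in> {0..1} \<rightarrow> {0..1} \<and> f 0 = 0 \<and> f 1 = 0 \<and>
     mono_on {0..1} (\<lambda>u. f u + u) \<and> antimono_on {0<..1} (\<lambda>u. f u / u)"

definition rmm_copula :: "(real \<Rightarrow> real) \<Rightarrow> (real \<Rightarrow> real) \<Rightarrow> real \<Rightarrow> real \<Rightarrow> real" where
  "rmm_copula f g u v = max 0 (u * v - f u * g v)"

definition left_lim :: "(real \<Rightarrow> real) \<Rightarrow> real \<Rightarrow> real" where
  "left_lim F x = Lim (at_left x) F"

definition quantile :: "(real \<Rightarrow> real) \<Rightarrow> real \<Rightarrow> ereal" where
  "quantile F u = Inf (ereal ` {x. u \<le> F x})"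

(* Only used for 0 < u < 1, where the quantile of a distribution function is finite. *)
definition real_quantile :: "(real \<Rightarrow> real) \<Rightarrow> real \<Rightarrow> real" where
  "real_quantile F u = real_of_ereal (quantile F u)"

definition gap_upper :: "(real \<Rightarrow> real) \<Rightarrow> real \<Rightarrow> real" where
  "gap_upper F u = F (real_quantile F u)"

definition gap_lower :: "(real \<Rightarrow> real) \<Rightarrow> real \<Rightarrow> real" where
  "gap_lower F u = left_lim F (real_quantile F u)"

(* The auxiliary function of (FX, FU) restricted to im FU \<union> {0,1}. *)
definition aux_fun_im :: "(real \<Rightarrow> real) \<Rightarrow> (real \<Rightarrow> real) \<Rightarrow> real \<Rightarrow> real" where
  "aux_fun_im FX FU u =
     (if u = 0 then 0 else if u = 1 then 1 else FX (real_quantile FU u))"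

(* The value at the left end of the gap containing u is the left limit of the auxiliary
   function itself at gap_lower FU u (and 0 if gap_lower FU u = 0). Taking this literally
   would make the definition circular, so the left limit is given by its value
   FX(FU^{-1}(u)-). The lemmas aux_fun_tendsto_gap_lower and aux_fun_gap below
   show that this is indeed the left limit of aux_fun, for FU = FX * G. *)
definition aux_fun_gap_left :: "(real \<Rightarrow> real) \<Rightarrow> (real \<Rightarrow> real) \<Rightarrow> real \<Rightarrow> real" where
  "aux_fun_gap_left FX FU u =
     (if gap_lower FU u = 0 then 0 else left_lim FX (real_quantile FU u))"

definition aux_fun :: "(real \<Rightarrow> real) \<Rightarrow> (real \<Rightarrow> real) \<Rightarrow> real \<Rightarrow> real" where
  "aux_fun FX FU u =
     (if u \<in> range FU \<union> {0, 1} then aux_fun_im FX FU u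
      else (aux_fun_im FX FU (gap_upper FU u) - aux_fun_gap_left FX FU u)
             / (gap_upper FU u - gap_lower FU u) * (u - gap_lower FU u)
           + aux_fun_gap_left FX FU u)"

lemma left_lim_cdf:
  assumes "real_distribution \<mu>"
  shows "(cdf \<mu> \<longlongrightarrow> left_lim (cdf \<mu>) x) (at_left x)"
proof -
  interpret real_distribution \<mu> by fact
  show ?thesis
    unfolding left_lim_def using cdf_at_left[of x] by (simp add: tendsto_Lim)
qed

context
  fixes \<mu> \<nu> :: "real measure" and P G F :: "real \<Rightarrow> real"
  assumes mu: "real_distribution \<mu>" and nu: "real_distribution \<nu>"
  defines "P \<equiv> cdf \<mu>" and "G \<equiv> cdf \<nu>" and "F \<equiv> (\<lambda>x. cdf \<mu> x * cdf \<nu> x)"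
begin

interpretation mu: real_distribution \<mu> by (rule mu)
interpretation nu: real_distribution \<nu> by (rule nu)

private lemma F_eq: "F x = P x * G x"
  by (simp add: F_def P_def G_def)

private lemma P_mono: "x \<le> y \<Longrightarrow> P x \<le> P y"
  unfolding P_def by (rule mu.cdf_nondecreasing)

private lemma G_mono: "x \<le> y \<Longrightarrow> G x \<le> G y"
  unfolding G_def by (rule nu.cdf_nondecreasing)

private lemma P_bounds: "0 \<le> P x" "P x \<le> 1"
  unfolding P_def by (simp_all add: mu.cdf_nonneg mu.cdf_bounded_prob)

private lemma G_bounds: "0 \<le> G x" "G x \<le> 1"
  unfolding G_def by (simp_all add: nu.cdf_nonneg nu.cdf_bounded_prob)

private lemma F_mono: "x \<le> y \<Longrightarrow> F x \<le> F y"
  unfolding F_eq by (intro mult_mono P_mono G_mono P_bounds G_bounds)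

private lemma F_le_P: "F x \<le> P x"
  unfolding F_eq using P_bounds[of x] G_bounds[of x] by (simp add: mult_left_le)

private lemma F_nonneg: "0 \<le> F x"
  unfolding F_eq using P_bounds[of x] G_bounds[of x] by simp

private lemma P_left: "(P \<longlongrightarrow> left_lim P x) (at_left x)"
  unfolding P_def by (rule left_lim_cdf[OF mu])

private lemma G_left: "(G \<longlongrightarrow> left_lim G x) (at_left x)"
  unfolding G_def by (rule left_lim_cdf[OF nu])

private lemma F_left_eq: "left_lim F x = left_lim P x * left_lim G x"
proof -
  have "(F \<longlongrightarrow> left_lim P x * left_lim G x) (at_left x)"
    unfolding F_eq[abs_def] by (intro tendsto_mult P_left G_left)
  then show ?thesis
    unfolding left_lim_def[of F] by (simp add: tendsto_Lim)
qed

private lemma F_left: "(F \<longlongrightarrow> left_lim F x) (at_left x)"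
  unfolding F_left_eq unfolding F_eq[abs_def] by (intro tendsto_mult P_left G_left)

private lemma left_ge:
  assumes H: "(H \<longlongrightarrow> left_lim H x) (at_left x)" and m: "\<And>a b. a \<le> b \<Longrightarrow> H a \<le> H b"
    and "t < x"
  shows "H t \<le> left_lim H (x::real)"
proof -
  have "eventually (\<lambda>s. H t \<le> H s) (at_left x)"
    using eventually_at_left_real[OF \<open>t < x\<close>] by eventually_elim (auto intro: m)
  then show ?thesis
    using H by (intro tendsto_lowerbound) auto
qed

private lemma left_le:
  assumes H: "(H \<longlongrightarrow> left_lim H x) (at_left x)" and m: "\<And>a b. a \<le> b \<Longrightarrow> H a \<le> H b"
    and "\<And>s. s < x \<Longrightarrow> H s \<le> b"
  shows "left_lim H (x::real) \<le> b"
proof -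
  have "eventually (\<lambda>s. H s \<le> b) (at_left x)"
    using eventually_at_left_real[of "x - 1" x, simplified] by eventually_elim (auto intro: assms(3))
  then show ?thesis
    using H by (intro tendsto_upperbound) auto
qed

private lemma cancel:
  assumes "F x = F y" "0 < F x" shows "P x = P y"
proof -
  have *: "P a = P b" if ab: "a \<le> b" "F a = F b" "0 < F a" for a b
  proof (rule antisym[OF P_mono[OF ab(1)]], rule ccontr)
    assume "\<not> P b \<le> P a"
    then have "P a < P b" by simp
    have "P a * G a > 0"
      using ab(3) by (simp only: F_eq)
    then have Ga: "0 < G a"
      using P_bounds(1)[of a] by (simp only: zero_less_mult_iff) linarith
    have "P a * G a < P b * G a"
      using \<open>P a < P b\<close> Ga by (rule mult_strict_right_mono)
    also have "\<dots> \<le> P b * G b"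
      using G_mono[OF ab(1)] P_bounds(1) by (rule mult_left_mono)
    finally show False
      using ab(2) by (simp only: F_eq)
  qed
  show ?thesis
    by (metis * assms linear)
qed

private lemma left_cancel:
  assumes "left_lim F x = F x" "0 < F x" shows "left_lim P x = P x"
proof (rule antisym, rule left_le[OF P_left P_mono P_mono], assumption, simp, rule ccontr)
  assume "\<not> P x \<le> left_lim P x"
  moreover have "left_lim G x \<le> G x"
    by (rule left_le[OF G_left G_mono G_mono]) auto
  moreover have "0 < G x"
    using assms G_bounds[of x] P_bounds[of x] by (auto simp: F_eq zero_less_mult_iff)
  moreover have "0 \<le> left_lim P x"
    using left_ge[OF P_left P_mono, of "x - 1" x] P_bounds(1)[of "x - 1"] by simp
  ultimately have "left_lim P x * left_lim G x < P x * G x"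
    by (meson leI mult_left_mono mult_strict_right_mono order_le_less_trans)
  then show False using assms by (simp add: F_eq F_left_eq)
qed

private lemma F_right: "continuous (at_right x) F"
  unfolding F_def
  by (intro continuous_mult mu.cdf_is_right_cont nu.cdf_is_right_cont)

private lemma quantile_iff:
  assumes u: "0 < u" "u < 1"
  shows "u \<le> F t \<longleftrightarrow> real_quantile F u \<le> t"
proof -
  let ?S = "{x. u \<le> F x}"
  have "(F \<longlongrightarrow> 1 * 1) at_top" "(F \<longlongrightarrow> 0 * 0) at_bot"
    unfolding F_def
    by (intro tendsto_mult mu.cdf_lim_at_top_prob nu.cdf_lim_at_top_prob
        mu.cdf_lim_at_bot nu.cdf_lim_at_bot)+
  then have "eventually (\<lambda>x. u < F x) at_top" "eventually (\<lambda>x. F x < u) at_bot"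
    using u by (auto dest: order_tendstoD)
  then obtain a b where a: "u < F a" and b: "F b < u"
    by (metis eventually_happens' trivial_limit_at_top_linorder trivial_limit_at_bot_linorder)
  have lb: "b \<le> x" if "x \<in> ?S" for x
    using that b F_mono[of x b] by force
  have ne: "?S \<noteq> {}"
    using less_imp_le[OF a] by blast
  have bdd: "bdd_below ?S"
    using lb by (rule bdd_belowI)
  have "quantile F u = ereal (Inf ?S)"
    unfolding quantile_def
    by (rule ereal_Inf'[symmetric]) (use ne bdd in auto)
  then have q: "real_quantile F u = Inf ?S"
    by (simp add: real_quantile_def)
  have "u \<le> F (Inf ?S)"
  proof -
    have "eventually (\<lambda>x. u \<le> F x) (at_right (Inf ?S))"
    proof -
      have "u \<le> F x" if "Inf ?S < x" for x
        using that cInf_lessD[OF ne that] F_mono by (meson less_imp_le mem_Collect_eq order_trans)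
      then show ?thesis
        by (auto simp: eventually_at_filter)
    qed
    then show ?thesis
      using F_right[of "Inf ?S"] unfolding continuous_within
      by (intro tendsto_lowerbound) auto
  qed
  then show ?thesis
    unfolding q using F_mono[of "Inf ?S" t] cInf_lower[OF _ bdd, of t] by auto
qed

private lemma quantile_eqI:
  assumes "0 < u" "u < 1" "u \<le> F r" "\<And>t. t < r \<Longrightarrow> F t < u"
  shows "real_quantile F u = r"
  using quantile_iff[OF assms(1,2), of r] quantile_iff[OF assms(1,2), of "real_quantile F u"]
    assms(3) assms(4)[of "real_quantile F u"] by force

private lemma gap_facts:
  assumes u: "0 < u" "u < 1" "u \<notin> range F" and r: "r = real_quantile F u"
  shows "gap_upper F u = F r" "u < F r" "gap_lower F u = left_lim F r" "left_lim F r \<le> u"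
    "aux_fun_im P F (gap_upper F u) = P r"
proof -
  show up: "gap_upper F u = F r" and "gap_lower F u = left_lim F r"
    by (simp_all add: gap_upper_def gap_lower_def r)
  show u_less: "u < F r"
    using quantile_iff[OF u(1,2), of r] r u(3) by (metis order_le_less order_refl rangeI)
  have less: "F t < u" if "t < r" for t
    using quantile_iff[OF u(1,2), of t] that r by simp
  then show "left_lim F r \<le> u"
    by (intro left_le[OF F_left F_mono]) (auto intro: less_imp_le)
  show "aux_fun_im P F (gap_upper F u) = P r"
  proof (cases "F r = 1")
    case True
    then have "P r = 1"
      using F_le_P[of r] P_bounds[of r] by simp
    then show ?thesis
      using True by (simp add: up aux_fun_im_def)
  next
    case False
    then have "F r < 1"
      using F_le_P[of r] P_bounds[of r] by linarith
    then have "real_quantile F (F r) = r"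
      using u u_less less by (intro quantile_eqI) (auto intro: order_less_trans)
    then show ?thesis
      using False u u_less by (auto simp: up aux_fun_im_def)
  qed
qed

private lemma aux_gap:
  assumes "0 < u" "u < 1" "u \<notin> range F" "r = real_quantile F u"
  shows "aux_fun P F u =
     (P r - aux_fun_gap_left P F u) / (F r - left_lim F r) * (u - left_lim F r)
       + aux_fun_gap_left P F u"
  using gap_facts[OF assms] assms by (simp add: aux_fun_def)

private lemma aux_gap_bounds:
  assumes "0 < u" "u < 1" "u \<notin> range F" "r = real_quantile F u"
  shows "aux_fun_gap_left P F u \<le> aux_fun P F u" "aux_fun P F u \<le> P r"
proof -
  let ?l = "aux_fun_gap_left P F u" and ?w = "(u - left_lim F r) / (F r - left_lim F r)"
  have l: "?l \<le> P r"
    using P_bounds left_le[OF P_left P_mono P_mono, of r r] assms(4)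
    by (auto simp: aux_fun_gap_left_def)
  have w: "0 \<le> ?w" "?w \<le> 1"
    using gap_facts[OF assms] by (auto simp: divide_simps)
  have eq: "aux_fun P F u = ?l + ?w * (P r - ?l)"
    by (simp add: aux_gap[OF assms])
  show "?l \<le> aux_fun P F u"
    unfolding eq using mult_nonneg_nonneg[OF w(1), of "P r - ?l"] l by simp
  show "aux_fun P F u \<le> P r"
    unfolding eq using w l mult_right_mono[of ?w 1 "P r - ?l"] by simp
qed

private lemma aux_lower:
  assumes s: "0 < s" "s < 1" and t: "F t \<le> s" "0 < F t"
  shows "P t \<le> aux_fun P F s"
proof (cases "s \<in> range F")
  case True
  define r where "r = real_quantile F s"
  from True obtain x where x: "s = F x" by auto
  have "r \<le> x" and sr: "s \<le> F r"
    using quantile_iff[OF s] x r_def by auto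
  with x have Fr: "F r = s"
    using F_mono[of r x] by simp
  have "P t \<le> P r"
  proof (cases "t \<le> r")
    case True
    then show ?thesis by (rule P_mono)
  next
    case False
    then have "F t = F r"
      using F_mono[of r t] t Fr by simp
    then show ?thesis
      using cancel[of t r] t by simp
  qed
  then show ?thesis
    using True s by (simp add: aux_fun_def aux_fun_im_def r_def)
next
  case False
  define r where "r = real_quantile F s"
  note g = gap_facts[OF s False r_def]
  have "t < r"
    using g(2) t F_mono[of r t] by force
  then have "P t \<le> left_lim P r" "F t \<le> left_lim F r"
    by (auto intro: left_ge P_left F_left P_mono F_mono)
  then have "P t \<le> aux_fun_gap_left P F s"
    using g t by (simp add: aux_fun_gap_left_def r_def)
  then show ?thesis
    using aux_gap_bounds[OF s False r_def] by simp
qed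

private lemma aux_upper:
  assumes s: "0 < s" "s < 1" and t: "s \<le> F t"
  shows "aux_fun P F s \<le> P t"
proof -
  define r where "r = real_quantile F s"
  have "P r \<le> P t"
    using quantile_iff[OF s] t r_def by (auto intro: P_mono)
  moreover have "aux_fun P F s \<le> P r"
  proof (cases "s \<in> range F")
    case True
    then show ?thesis
      using s by (simp add: aux_fun_def aux_fun_im_def r_def)
  next
    case False
    then show ?thesis
      using aux_gap_bounds[OF s False r_def] by simp
  qed
  ultimately show ?thesis by simp
qed

private lemma aux_lower_ev:
  assumes c: "0 < c" "c < 1" and t: "F t < c" "0 < F t" "a < P t"
  shows "eventually (\<lambda>s. a < aux_fun P F s) (at_left c)"
  using eventually_at_left_real[OF t(1)]
proof eventually_elim
  case (elim s)
  then show ?case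
    using aux_lower[of s t] c t by auto
qed

private lemma jump_tendsto:
  assumes c: "0 < c" "c < 1" "F r = c" and r: "r = real_quantile F c"
    and j: "left_lim F r < c"
  shows "(aux_fun P F \<longlongrightarrow> P r) (at_left c)"
proof -
  let ?c' = "left_lim F r"
  define l where "l = (if ?c' = 0 then 0 else left_lim P r)"
  have c': "0 \<le> ?c'"
    using left_ge[OF F_left F_mono, of "r - 1" r] F_nonneg[of "r - 1"] by simp
  have eq: "aux_fun P F s = (P r - l) / (c - ?c') * (s - ?c') + l" if s: "?c' < s" "s < c" for s
  proof -
    have s01: "0 < s" "s < 1"
      using s c c' by auto
    have less: "F t < s" if "t < r" for t
      using left_ge[OF F_left F_mono that] s by simp
    have "s \<noteq> F t" for t
      using less[of t] F_mono[of r t] c s by (cases "t < r") auto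
    then have nr: "s \<notin> range F"
      by auto
    have q: "r = real_quantile F s"
      using s s01 c less by (intro quantile_eqI[symmetric]) auto
    have "aux_fun_gap_left P F s = l"
      using gap_facts[OF s01 nr q] q by (simp add: aux_fun_gap_left_def l_def)
    then show ?thesis
      using aux_gap[OF s01 nr q] c by simp
  qed
  have "((\<lambda>s. (P r - l) / (c - ?c') * (s - ?c') + l)
      \<longlongrightarrow> (P r - l) / (c - ?c') * (c - ?c') + l) (at_left c)"
    by (intro tendsto_intros)
  also have "(P r - l) / (c - ?c') * (c - ?c') + l = P r"
    using j by simp
  finally show ?thesis
  proof (rule Lim_transform_eventually)
    show "\<forall>\<^sub>F s in at_left c. (P r - l) / (c - ?c') * (s - ?c') + l = aux_fun P F s"
      using eventually_at_left_real[OF j] by eventually_elim (auto simp: eq)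
  qed
qed

lemma aux_fun_tendsto_gap_lower:
  assumes u: "0 < u" "u < 1" "u \<notin> range F" and pos: "gap_lower F u > 0"
  shows "(aux_fun P F \<longlongrightarrow> left_lim P (real_quantile F u)) (at_left (gap_lower F u))"
proof -
  define q c where "q = real_quantile F u" and "c = gap_lower F u"
  have c_eq: "c = left_lim F q" and c: "0 < c" "c < 1"
    using gap_facts[OF u q_def] u pos by (auto simp: c_def)
  have "(aux_fun P F \<longlongrightarrow> left_lim P q) (at_left c)"
  proof (rule order_tendstoI)
    fix a assume a: "left_lim P q < a"
    show "eventually (\<lambda>s. aux_fun P F s < a) (at_left c)"
      using eventually_at_left_real[OF c(1)]
    proof eventually_elim
      case (elim s)
      have "eventually (\<lambda>t. s < F t) (at_left q)"
        using F_left[of q] elim by (intro order_tendstoD) (auto simp: c_eq)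
      then have "eventually (\<lambda>t. s < F t \<and> t < q) (at_left q)"
        using eventually_at_left_real[of "q - 1" q, simplified] by eventually_elim auto
      then obtain t where "s < F t" "t < q"
        using eventually_happens'[of "at_left q"] by auto
      moreover from \<open>t < q\<close> have "P t \<le> left_lim P q"
        by (intro left_ge P_left P_mono)
      ultimately show ?case
        using aux_upper[of s t] a elim c by auto
    qed
  next
    fix a assume a: "a < left_lim P q"
    have "eventually (\<lambda>t. a < P t) (at_left q)" "eventually (\<lambda>t. 0 < F t) (at_left q)"
      using P_left[of q] F_left[of q] a c by (auto intro: order_tendstoD simp: c_eq)
    then have "eventually (\<lambda>t. a < P t \<and> 0 < F t \<and> t < q) (at_left q)"
      using eventually_at_left_real[of "q - 1" q, simplified] by eventually_elim auto
    then obtain t where t: "a < P t" "0 < F t" "t < q"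
      using eventually_happens'[of "at_left q"] by auto
    have "F t \<le> c"
      unfolding c_eq using t(3) by (intro left_ge F_left F_mono)
    show "eventually (\<lambda>s. a < aux_fun P F s) (at_left c)"
    proof (cases "F t < c")
      case True
      then show ?thesis
        using t by (intro aux_lower_ev[OF c]) auto
    next
      case False
      with \<open>F t \<le> c\<close> have Ft: "F t = c" by simp
      define r where "r = real_quantile F c"
      have "r \<le> t" "c \<le> F r"
        using quantile_iff[OF c] Ft r_def by auto
      then have Fr: "F r = c"
        using F_mono[of r t] Ft by simp
      have Pr: "a < P r"
        using cancel[of r t] Fr Ft c t by simp
      show ?thesis
      proof (cases "left_lim F r < c")
        case True
        then show ?thesis
          using jump_tendsto[OF c Fr r_def] Pr by (auto dest: order_tendstoD)
      next
        case False
        moreover have "left_lim F r \<le> c"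
          unfolding Fr[symmetric] by (rule left_le[OF F_left F_mono F_mono]) auto
        ultimately have eq: "left_lim F r = F r" using Fr by simp
        then have "left_lim P r = P r"
          using Fr c by (intro left_cancel) auto
        then have "eventually (\<lambda>t. a < P t) (at_left r)" "eventually (\<lambda>t. 0 < F t) (at_left r)"
          using P_left[of r] F_left[of r] Pr c by (auto intro: order_tendstoD simp: eq Fr)
        then have "eventually (\<lambda>t. a < P t \<and> 0 < F t \<and> t < r) (at_left r)"
          using eventually_at_left_real[of "r - 1" r, simplified] by eventually_elim auto
        then obtain t' where t': "a < P t'" "0 < F t'" "t' < r"
          using eventually_happens'[of "at_left r"] by auto
        have "F t' < c"
          using quantile_iff[OF c, of t'] t' r_def by simp
        then show ?thesis
          using t' by (intro aux_lower_ev[OF c]) auto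
      qed
    qed
  qed
  then show ?thesis
    by (simp add: q_def c_def)
qed

lemma aux_fun_gap:
  assumes u: "0 < u" "u < 1" "u \<notin> range F"
  defines "up \<equiv> gap_upper F u" and "lo \<equiv> gap_lower F u"
  defines "l \<equiv> (if lo = 0 then 0 else left_lim (aux_fun P F) lo)"
  shows "aux_fun P F u = (aux_fun P F up - l) / (up - lo) * (u - lo) + l"
proof -
  have "0 \<le> lo"
    using left_ge[OF F_left F_mono, of "real_quantile F u - 1" "real_quantile F u"]
      F_nonneg[of "real_quantile F u - 1"]
    by (simp add: lo_def gap_lower_def)
  then have "l = aux_fun_gap_left P F u"
    using aux_fun_tendsto_gap_lower[OF u]
    by (auto simp: l_def aux_fun_gap_left_def lo_def left_lim_def[of "aux_fun P F"]
        intro!: tendsto_Lim)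
  moreover have "aux_fun P F up = aux_fun_im P F up"
    by (simp add: aux_fun_def up_def gap_upper_def)
  ultimately show ?thesis
    using u by (simp add: aux_fun_def up_def lo_def)
qed

end

end

theory Submission
  imports Defs
begin

text \<open>Let \<open>P\<close> and \<open>G\<close> be the distribution functions of \<open>X\<close> and \<open>Z1\<close>, so that \<open>F = P G\<close> is that of
  \<open>U\<close>. The auxiliary function maps \<open>F x\<close> to \<open>P x\<close> and is affine on the gaps of the range of \<open>F\<close>;
  hence it increases, and its ratio to the identity, which at \<open>F x\<close> is \<open>1 / G x\<close>, decreases. These
  are the conditions on a generating function. Writing \<open>Q\<close> and \<open>H\<close> for the distribution functions
  of \<open>Y\<close> and \<open>Z2\<close>, the joint distribution function of \<open>U\<close> and \<open>V\<close> is \<open>P Q max(0, G + H - 1)\<close>, and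
  \<open>P Q (G + H - 1) = (P G) (Q H) - (P - P G) (Q - Q H)\<close>.\<close>

section \<open>Reflected maxmin copulas\<close>

lemma rmm_generatorD:
  assumes "rmm_generator f"
  shows "0 \<le> u \<Longrightarrow> u \<le> 1 \<Longrightarrow> 0 \<le> f u" "f 0 = 0" "f 1 = 0"
    and "0 \<le> u \<Longrightarrow> u \<le> u' \<Longrightarrow> u' \<le> 1 \<Longrightarrow> f u + u \<le> f u' + u'"
    and "0 \<le> u \<Longrightarrow> u \<le> u' \<Longrightarrow> u' \<le> 1 \<Longrightarrow> f u' * u \<le> f u * u'"
proof -
  show "0 \<le> f u" if "0 \<le> u" "u \<le> 1"
    using assms that by (auto simp: rmm_generator_def Pi_iff)
  show zero: "f 0 = 0" and "f 1 = 0"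
    using assms by (auto simp: rmm_generator_def)
  show "f u + u \<le> f u' + u'" if "0 \<le> u" "u \<le> u'" "u' \<le> 1"
    using assms that unfolding rmm_generator_def by (auto dest!: mono_onD[of _ _ u u'])
  show "f u' * u \<le> f u * u'" if "0 \<le> u" "u \<le> u'" "u' \<le> 1"
  proof (cases "u = 0")
    case False
    then have "f u' / u' \<le> f u / u"
      using assms that unfolding rmm_generator_def by (auto dest!: monotone_onD[of _ _ _ _ u u'])
    then show ?thesis
      using False that by (simp add: field_simps)
  qed (simp add: zero)
qed

lemma rmm_copula_commute: "rmm_copula f g u v = rmm_copula g f v u"
  by (simp add: rmm_copula_def mult.commute)

text \<open>Dividing by \<open>v\<close> gives \<open>u - f u * (g v / v)\<close>, which grows with
  \<open>v\<close> because \<open>g v / v\<close> decreases. Positivity allows the factor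
  \<open>v\<close> to be enlarged to \<open>v'\<close> before \<open>v\<close> is cancelled.\<close>

lemma rmm_form_mono:
  assumes f: "rmm_generator f" and g: "rmm_generator g"
    and u: "0 \<le> u" "u \<le> 1" and v: "0 \<le> v" "v \<le> v'" "v' \<le> 1"
    and pos: "0 < u * v - f u * g v"
  shows "u * v - f u * g v \<le> u * v' - f u * g v'"
proof -
  have "0 < v"
    using pos v rmm_generatorD(2)[OF g] by (cases "v = 0") auto
  have "v * (u * v - f u * g v) \<le> v' * (u * v - f u * g v)"
    using v pos by (intro mult_right_mono) auto
  also have "\<dots> \<le> v * (u * v' - f u * g v')"
    using mult_left_mono[OF rmm_generatorD(5)[OF g v] rmm_generatorD(1)[OF f u]]
    by (simp add: algebra_simps)
  finally show ?thesis
    using \<open>0 < v\<close> by simp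
qed

lemma rmm_copula_mono:
  assumes "rmm_generator f" "rmm_generator g"
    and "0 \<le> u" "u \<le> 1" "0 \<le> v" "v \<le> v'" "v' \<le> 1"
  shows "rmm_copula f g u v \<le> rmm_copula f g u v'"
  using rmm_form_mono[OF assms] by (force simp: rmm_copula_def)

text \<open>This is the rectangle inequality for \<open>u * v - f u * g v\<close> without the
  maximum. If both generators decrease, (G2) bounds the decreases by \<open>u' - u\<close> and
  \<open>v' - v\<close>; opposite signs are trivial. If both increase, (G3) bounds the increment of
  \<open>g\<close> by \<open>g v * (v' - v) / v\<close>, and the form's growth in its first argument
  absorbs \<open>g v\<close>.\<close>

lemma rmm_generator_increment_mult_le:
  assumes f: "rmm_generator f" and g: "rmm_generator g"
    and u: "0 \<le> u" "u \<le> u'" "u' \<le> 1" and v: "0 \<le> v" "v \<le> v'" "v' \<le> 1"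
    and pos_u: "0 < u * v' - f u * g v'" and pos_v: "0 < u' * v - f u' * g v"
  shows "(f u' - f u) * (g v' - g v) \<le> (u' - u) * (v' - v)"
proof -
  consider "f u' - f u \<le> 0" "g v' - g v \<le> 0" | "f u' - f u \<le> 0" "g v' - g v \<ge> 0"
    | "f u' - f u \<ge> 0" "g v' - g v \<le> 0" | "f u' - f u \<ge> 0" "g v' - g v \<ge> 0"
    by linarith
  then show ?thesis
  proof cases
    case 1
    then have "(f u - f u') * (g v - g v') \<le> (u' - u) * (v' - v)"
      using rmm_generatorD(4)[OF f u] rmm_generatorD(4)[OF g v] u v by (intro mult_mono) auto
    then show ?thesis
      by (simp add: algebra_simps)
  next
    case 2
    then show ?thesis
      using u v mult_nonpos_nonneg[OF 2] mult_nonneg_nonneg[of "u' - u" "v' - v"] by linarith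
  next
    case 3
    then show ?thesis
      using u v mult_nonneg_nonpos[OF 3] mult_nonneg_nonneg[of "u' - u" "v' - v"] by linarith
  next
    case 4
    have "0 < v"
      using pos_v v rmm_generatorD(2)[OF g] by (cases "v = 0") auto
    \<comment> \<open>Rearranged, the form at \<open>(u, v)\<close> is at most the form at
      \<open>(u', v)\<close>. If the former is not positive, \<open>pos_v\<close> gives this at
      once.\<close>
    have slope: "(f u' - f u) * g v \<le> (u' - u) * v"
    proof (cases "0 < v * u - g v * f u")
      case True
      then have "v * u - g v * f u \<le> v * u' - g v * f u'"
        using v by (intro rmm_form_mono[OF g f _ _ u]) auto
      then show ?thesis
        by (simp add: algebra_simps)
    next
      case False
      then show ?thesis
        using pos_v by (simp add: algebra_simps)
    qed
    have "(f u' - f u) * (g v' - g v) * v = (f u' - f u) * ((g v' - g v) * v)"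
      by simp
    also have "\<dots> \<le> (f u' - f u) * (g v * (v' - v))"
      using rmm_generatorD(5)[OF g v] 4 by (intro mult_left_mono) (auto simp: algebra_simps)
    also have "\<dots> \<le> (u' - u) * v * (v' - v)"
      using mult_right_mono[OF slope, of "v' - v"] v by (simp add: mult.assoc)
    finally show ?thesis
      using \<open>0 < v\<close> by (simp add: mult.assoc mult.commute[of v] flip: mult.assoc)
  qed
qed

lemma copula_rmm_copula:
  assumes f: "rmm_generator f" and g: "rmm_generator g"
  shows "copula (rmm_copula f g)"
  unfolding copula_def
proof (intro conjI ballI impI)
  fix u v :: real assume uv: "u \<in> {0..1}" "v \<in> {0..1}"
  then have "u * v \<le> 1" "0 \<le> f u * g v"
    using rmm_generatorD(1)[OF f] rmm_generatorD(1)[OF g] by (auto intro: mult_le_one)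
  then show "rmm_copula f g u v \<in> {0..1}"
    by (auto simp: rmm_copula_def)
next
  fix u :: real assume "u \<in> {0..1}"
  then show "rmm_copula f g u 0 = 0" "rmm_copula f g 0 u = 0"
    "rmm_copula f g u 1 = u" "rmm_copula f g 1 u = u"
    using rmm_generatorD(2,3)[OF f] rmm_generatorD(2,3)[OF g] by (auto simp: rmm_copula_def)
next
  fix u u' v v' :: real
  assume "u \<in> {0..1}" "u' \<in> {0..1}" "v \<in> {0..1}" "v' \<in> {0..1}" "u \<le> u'" "v \<le> v'"
  then have u: "0 \<le> u" "u \<le> u'" "u' \<le> 1" and v: "0 \<le> v" "v \<le> v'" "v' \<le> 1"
    and u': "0 \<le> u'" "u \<le> 1" and v': "0 \<le> v'" "v \<le> 1"
    by auto
  have mono: "rmm_copula f g u' v \<le> rmm_copula f g u' v'"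
    "rmm_copula f g u v' \<le> rmm_copula f g u' v'"
    using rmm_copula_mono[OF f g u'(1) u(3) v] rmm_copula_mono[OF g f v'(1) v(3) u]
    by (simp_all add: rmm_copula_commute[of f g])
  have nonneg: "0 \<le> rmm_copula f g u v"
    by (simp add: rmm_copula_def)
  show "rmm_copula f g u' v' - rmm_copula f g u v' - rmm_copula f g u' v + rmm_copula f g u v \<ge> 0"
  proof (cases "0 < u * v' - f u * g v' \<and> 0 < u' * v - f u' * g v")
    case True
    then have "(f u' - f u) * (g v' - g v) \<le> (u' - u) * (v' - v)"
      using rmm_generator_increment_mult_le[OF f g u v] by simp
    then have "0 \<le> (u' * v' - f u' * g v') - (u * v' - f u * g v')
        - (u' * v - f u' * g v) + (u * v - f u * g v)"
      by (simp add: algebra_simps)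
    then show ?thesis
      using True unfolding rmm_copula_def by linarith
  next
    case False
    then have "rmm_copula f g u v' = 0 \<or> rmm_copula f g u' v = 0"
      by (auto simp: rmm_copula_def)
    then show ?thesis
      using mono nonneg by linarith
  qed
qed

section \<open>The auxiliary function of a product of distribution functions\<close>

lemma (in real_distribution) left_lim_cdf_eq: "left_lim (cdf M) x = measure M {..<x}"
  unfolding left_lim_def using cdf_at_left[of x] by (simp add: tendsto_Lim)

text \<open>The pseudoinverse \<open>I u\<close> has this property, so the set in
  \<open>quantile\<close> is the half-line \<open>{q..}\<close>, and its extended-real infimum is
  the real number \<open>q\<close>.\<close>

lemma (in real_distribution) real_quantile_le_iff:
  assumes "0 < u" "u < 1"
  shows "real_quantile (cdf M) u \<le> t \<longleftrightarrow> u \<le> cdf M t"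
proof -
  interpret cdf_distribution M ..
  define q where "q = I u"
  have q: "u \<le> cdf M x \<longleftrightarrow> q \<le> x" for x
    unfolding q_def by (rule pseudoinverse[OF assms])
  have "quantile (cdf M) u = ereal (Inf {x. q \<le> x})"
    unfolding quantile_def q by (rule ereal_Inf'[symmetric]) auto
  also have "{x. q \<le> x} = {q..}"
    by auto
  finally show ?thesis
    by (simp add: real_quantile_def q)
qed

text \<open>The measures stand for the laws of \<open>X\<close>, \<open>Z1\<close>,
  \<open>U\<close>, and equally for those of \<open>Y\<close>, \<open>Z2\<close>, \<open>V\<close>.
  Independence enters only through the product formula.\<close>

locale cdf_product =
  mu: real_distribution \<mu> + nu: real_distribution \<nu> + lam: real_distribution \<kappa>
  for \<mu> \<nu> \<kappa> :: "real measure" +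
  assumes cdf_eq_mult: "cdf \<kappa> x = cdf \<mu> x * cdf \<nu> x"
begin

abbreviation "P \<equiv> cdf \<mu>"
abbreviation "G \<equiv> cdf \<nu>"
abbreviation "F \<equiv> cdf \<kappa>"
text \<open>Masses of open half-lines are the left limits of the distribution functions, so
  comparisons with left limits become inclusions of sets.\<close>

abbreviation "Pl x \<equiv> measure \<mu> {..<x}"
abbreviation "Gl x \<equiv> measure \<nu> {..<x}"
abbreviation "Fl x \<equiv> measure \<kappa> {..<x}"
abbreviation "A \<equiv> aux_fun P F"

lemma Fl_eq_mult: "Fl x = Pl x * Gl x"
proof (rule tendsto_unique[OF _ lam.cdf_at_left])
  show "(F \<longlongrightarrow> Pl x * Gl x) (at_left x)"
    unfolding cdf_eq_mult[abs_def] by (intro tendsto_mult mu.cdf_at_left nu.cdf_at_left)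
qed simp

lemma left_bounds:
  "Pl x \<le> P x" "Gl x \<le> G x" "Fl x \<le> F x"
  "t < x \<Longrightarrow> P t \<le> Pl x" "t < x \<Longrightarrow> G t \<le> Gl x" "t < x \<Longrightarrow> F t \<le> Fl x"
  unfolding cdf_def
  by (auto intro!: mu.finite_measure_mono nu.finite_measure_mono lam.finite_measure_mono)

text \<open>A positive product of nonnegative nondecreasing factors is constant only where both
  factors are. Hence a positive value \<open>F x\<close> determines \<open>P x\<close> and
  \<open>G x\<close>.\<close>

lemma cdf_cancel:
  assumes "F x = F y" "0 < F x"
  shows "P x = P y \<and> G x = G y"
proof -
  have *: "P a = P b \<and> G a = G b" if "a \<le> b" "F a = F b" "0 < F a" for a b
  proof -
    have "0 < P a" "0 < G a"
      using that(3) mu.cdf_nonneg[of a] nu.cdf_nonneg[of a]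
      by (auto simp: cdf_eq_mult zero_less_mult_iff)
    moreover have "P a \<le> P b" "G a \<le> G b"
      using that(1) by (auto intro: mu.cdf_nondecreasing nu.cdf_nondecreasing)
    moreover have "P a * G a = P b * G b"
      using that(2) by (simp add: cdf_eq_mult)
    moreover have "P a * G a < P b * G b" if "P a < P b \<or> G a < G b"
      using that calculation(1-4) by (auto intro: mult_less_le_imp_less mult_le_less_imp_less)
    ultimately show ?thesis
      by force
  qed
  show ?thesis
    using *[of x y] *[of y x] assms by linarith
qed

text \<open>On each gap, the points \<open>(u, A u)\<close> form a segment, whose left end is \<open>(Fl r, l)\<close>. The value
  \<open>w = 1\<close> covers the points of the range of \<^term>\<open>F\<close>.\<close>

lemma aux_fun_segment:
  assumes u: "0 < u" "u < 1"
  defines "r \<equiv> real_quantile F u"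
  defines "l \<equiv> if Fl r = 0 then 0 else Pl r"
  obtains w where "0 \<le> w" "w \<le> 1" "A u = (1 - w) * l + w * P r"
    "u = (1 - w) * (l * Gl r) + w * (P r * G r)" "u = F r \<Longrightarrow> w = 1"
proof -
  have q: "r \<le> t \<longleftrightarrow> u \<le> F t" for t
    unfolding r_def by (rule lam.real_quantile_le_iff[OF u])
  have uF: "u \<le> F r"
    using q[of r] by simp
  show thesis
  proof (cases "u \<in> range F")
    case True
    then obtain x where x: "u = F x" by auto
    then have "F r \<le> u"
      using q[of x] by (auto intro: lam.cdf_nondecreasing)
    then have "u = F r"
      using uF by simp
    moreover have "A u = P r"
      using True u by (simp add: aux_fun_def aux_fun_im_def r_def)
    ultimately show thesis
      by (intro that[of 1]) (simp_all add: cdf_eq_mult)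
  next
    case False
    then have uF': "u < F r"
      using uF by (metis order_le_less rangeI)
    have Fl_le: "Fl r \<le> u"
    proof (rule tendsto_upperbound[OF lam.cdf_at_left])
      have "F s \<le> u" if "s < r" for s
        using that q[of s] by simp
      then show "\<forall>\<^sub>F s in at_left r. F s \<le> u"
        by (auto simp: eventually_at_filter)
    qed simp
    \<comment> \<open>At 1 the value is set by convention, and \<open>F r = 1\<close> forces
      \<open>P r = 1\<close>. Otherwise the quantile \<open>r'\<close> of \<open>F r\<close>
      satisfies \<open>F r' = F r\<close>, and \<open>cdf_cancel\<close> gives
      \<open>P r' = P r\<close>.\<close>
    have "aux_fun_im P F (F r) = P r"
    proof (cases "F r = 1")
      case True
      then have "P r = 1"
        using mu.cdf_bounded_prob[of r] nu.cdf_bounded_prob[of r] mu.cdf_nonneg[of r]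
          mult_left_le[of "G r" "P r"] by (simp add: cdf_eq_mult)
      then show ?thesis
        using True by (simp add: aux_fun_im_def)
    next
      case False
      then have F1: "0 < F r" "F r < 1"
        using lam.cdf_bounded_prob[of r] uF' u by auto
      define r' where "r' = real_quantile F (F r)"
      have "r' \<le> r" "F r \<le> F r'"
        using lam.real_quantile_le_iff[OF F1, of r] lam.real_quantile_le_iff[OF F1, of r']
        by (simp_all add: r'_def)
      then have "F r' = F r"
        using lam.cdf_nondecreasing[of r' r] by simp
      then have "P r' = P r"
        using cdf_cancel[of r' r] F1 by simp
      then show ?thesis
        using F1 by (simp add: aux_fun_im_def r'_def)
    qed
    then have A: "A u = (P r - l) / (F r - Fl r) * (u - Fl r) + l"
      using False u by (simp add: aux_fun_def aux_fun_gap_left_def gap_upper_def gap_lower_def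
          lam.left_lim_cdf_eq mu.left_lim_cdf_eq l_def flip: r_def)
    \<comment> \<open>The relative position of \<open>u\<close> in the gap from \<open>Fl r\<close>
      to \<open>F r\<close>.\<close>
    define w where "w = (u - Fl r) / (F r - Fl r)"
    have w: "w * (F r - Fl r) = u - Fl r" "0 \<le> w" "w \<le> 1"
      using uF' Fl_le by (auto simp: w_def)
    \<comment> \<open>With the default \<open>l = 0\<close> both sides vanish, so the left end has
      the same form as the right end in either case.\<close>
    have "l * Gl r = Fl r"
      by (auto simp: l_def Fl_eq_mult)
    moreover have "A u = (P r - l) * w + l"
      unfolding A w_def by simp
    ultimately show thesis
      using w uF' by (intro that[of w]) (simp_all add: algebra_simps flip: cdf_eq_mult)
  qed
qed

section \<open>Bounds and monotonicity of the auxiliary function\<close>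

lemma aux_fun_nonneg:
  assumes u: "0 < u" "u < 1"
  shows "0 \<le> A u"
  by (rule aux_fun_segment[OF u]) (simp add: mu.cdf_nonneg)

text \<open>Here \<open>r <= t\<close>, so \<open>l\<close> and \<open>P r\<close> are at most
  \<open>P t\<close>, while \<open>Gl r\<close> and \<open>G r\<close> are at most
  \<open>G t\<close>. Both bounds follow by mixing the two ends of the segment with weight
  \<open>w\<close>.\<close>

lemma aux_fun_upper:
  assumes u: "0 < u" "u < 1" and t: "u \<le> F t"
  shows "A u \<le> P t" "u \<le> A u * G t"
proof -
  define r where "r = real_quantile F u"
  define l where "l = (if Fl r = 0 then 0 else Pl r)"
  obtain w where w: "0 \<le> w" "w \<le> 1" "A u = (1 - w) * l + w * P r"
    "u = (1 - w) * (l * Gl r) + w * (P r * G r)"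
    using aux_fun_segment[OF u] unfolding r_def l_def by metis
  have "r \<le> t"
    using lam.real_quantile_le_iff[OF u] t r_def by simp
  then have Pt: "P r \<le> P t" and Gt: "G r \<le> G t"
    by (auto intro: mu.cdf_nondecreasing nu.cdf_nondecreasing)
  have l: "0 \<le> l" "l \<le> P r"
    using left_bounds(1)[of r] mu.cdf_nonneg[of r] by (auto simp: l_def)
  show "A u \<le> P t"
    using convex_bound_le[of l "P t" "P r" "1 - w" w] l Pt w by simp
  have "(1 - w) * (l * Gl r) + w * (P r * G r) \<le> (1 - w) * (l * G t) + w * (P r * G t)"
    using w(1,2) l Gt left_bounds(2)[of r] mu.cdf_nonneg[of r]
    by (intro add_mono mult_left_mono) auto
  moreover have "A u * G t = (1 - w) * (l * G t) + w * (P r * G t)"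
    unfolding w(3) by (simp add: algebra_simps)
  ultimately show "u \<le> A u * G t"
    using w(4) by linarith
qed

text \<open>For \<open>t < r\<close> both ends of the segment dominate \<open>P t\<close> and
  \<open>G t\<close>. For \<open>r <= t\<close> the values \<open>u\<close>, \<open>F r\<close> and
  \<open>F t\<close> coincide, and \<open>cdf_cancel\<close> yields equality.\<close>

lemma aux_fun_lower:
  assumes u: "0 < u" "u < 1" and t: "F t \<le> u" "0 < F t"
  shows "P t \<le> A u" "A u * G t \<le> u"
proof -
  define r where "r = real_quantile F u"
  define l where "l = (if Fl r = 0 then 0 else Pl r)"
  obtain w where w: "0 \<le> w" "w \<le> 1" "A u = (1 - w) * l + w * P r"
    "u = (1 - w) * (l * Gl r) + w * (P r * G r)" and w1: "u = F r \<Longrightarrow> w = 1"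
    using aux_fun_segment[OF u] unfolding r_def l_def by metis
  have "P t \<le> A u \<and> A u * G t \<le> u"
  proof (cases "t < r")
    case True
    note b = left_bounds(4-6)[OF True]
    \<comment> \<open>Positivity of \<open>F t\<close> excludes the default value:
      \<open>0 < F t <= Fl r\<close>.\<close>
    have l: "l = Pl r"
      using b(3) t by (auto simp: l_def)
    have "0 \<le> l"
      by (simp add: l)
    have "(1 - w) * (l * G t) + w * (P r * G t) \<le> (1 - w) * (l * Gl r) + w * (P r * G r)"
      using w(1,2) \<open>0 \<le> l\<close> b left_bounds(2)[of r] mu.cdf_nonneg[of r]
      by (intro add_mono mult_left_mono) auto
    moreover have "A u * G t = (1 - w) * (l * G t) + w * (P r * G t)"
      unfolding w(3) by (simp add: algebra_simps)
    moreover have "(1 - w) * P t + w * P t \<le> (1 - w) * l + w * P r"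
      using w(1,2) b left_bounds(1)[of r] l by (intro add_mono mult_left_mono) auto
    moreover have "(1 - w) * P t + w * P t = P t"
      by (simp add: algebra_simps)
    ultimately show ?thesis
      using w(3,4) by linarith
  next
    case False
    then have "u \<le> F r" "F r \<le> F t"
      using lam.real_quantile_le_iff[OF u, of r] by (auto simp: r_def intro: lam.cdf_nondecreasing)
    then have eq: "u = F r" "F t = F r"
      using t by auto
    have "A u = P r"
      unfolding w(3) w1[OF eq(1)] by simp
    moreover have "P t = P r \<and> G t = G r"
      by (rule cdf_cancel[OF eq(2) t(2)])
    moreover have "P r * G r = u"
      unfolding eq(1) cdf_eq_mult ..
    ultimately show ?thesis
      by simp
  qed
  then show "P t \<le> A u" "A u * G t \<le> u"
    by auto
qed

text \<open>A value \<open>F t\<close> between \<open>u\<close> and \<open>v\<close> separates them: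
  the bounds above compare both sides through \<open>P t\<close> and \<open>G t\<close>. If there is
  none, both points lie on the segment of one gap.\<close>

lemma aux_fun_mono_ratio:
  assumes u: "0 < u" and uv: "u < v" and v: "v < 1"
  shows "A u \<le> A v \<and> A v * u \<le> A u * v"
proof (cases "\<exists>t. u \<le> F t \<and> F t \<le> v")
  case True
  then obtain t where t: "u \<le> F t" "F t \<le> v" by blast
  have pos: "0 < F t"
    using t u by simp
  have bu: "A u \<le> P t" "u \<le> A u * G t" and bv: "P t \<le> A v" "A v * G t \<le> v"
    using aux_fun_upper[of u t] aux_fun_lower[of v t] t pos assms by auto
  have "0 \<le> A v"
    using bv(1) mu.cdf_nonneg[of t] by simp
  moreover have "0 \<le> A u"
    using aux_fun_nonneg u uv v by simp
  ultimately have "A v * u \<le> A v * (A u * G t)" "A u * (A v * G t) \<le> A u * v"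
    using bu(2) bv(2) by (auto intro: mult_left_mono)
  then show ?thesis
    using bu(1) bv(1) by (simp add: mult.left_commute)
next
  case False
  define r where "r = real_quantile F u"
  define l where "l = (if Fl r = 0 then 0 else Pl r)"
  have u1: "u < 1" and v0: "0 < v"
    using assms by auto
  have uF: "u \<le> F r"
    using lam.real_quantile_le_iff[OF u u1, of r] by (simp add: r_def)
  then have vF: "v < F r"
    using False by force
  \<comment> \<open>\<open>F\<close> jumps over both \<open>u\<close> and \<open>v\<close> at
    \<open>r\<close>, so their quantiles agree and \<open>l\<close> is shared.\<close>
  have "real_quantile F v \<le> r"
    using lam.real_quantile_le_iff[OF v0 v] vF by simp
  moreover have "r \<le> real_quantile F v"
    unfolding r_def lam.real_quantile_le_iff[OF u u1]
    using lam.real_quantile_le_iff[OF v0 v, of "real_quantile F v"] uv by simp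
  ultimately have rv: "real_quantile F v = r"
    by simp
  obtain a where a: "A u = (1 - a) * l + a * P r"
    "u = (1 - a) * (l * Gl r) + a * (P r * G r)"
    using aux_fun_segment[OF u u1] unfolding r_def l_def by metis
  obtain b where b: "A v = (1 - b) * l + b * P r"
    "v = (1 - b) * (l * Gl r) + b * (P r * G r)"
    using aux_fun_segment[OF v0 v] unfolding rv l_def by metis
  have l: "0 \<le> l" "l \<le> P r"
    using left_bounds(1)[of r] mu.cdf_nonneg[of r] by (auto simp: l_def)
  have "l * Gl r \<le> P r * G r"
    using l left_bounds(2)[of r] mu.cdf_nonneg[of r] by (intro mult_mono) auto
  moreover have "0 < (b - a) * (P r * G r - l * Gl r)"
    using a(2) b(2) uv by (simp add: algebra_simps)
  ultimately have ab: "0 \<le> b - a"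
    by (simp add: zero_less_mult_iff)
  have "A v - A u = (b - a) * (P r - l)"
    unfolding a(1) b(1) by (simp add: algebra_simps)
  moreover have "0 \<le> (b - a) * (P r - l)"
    using ab l by simp
  \<comment> \<open>The left side is the determinant of two points on a segment:
    \<open>b - a\<close> times the determinant of its ends \<open>(l, l * Gl r)\<close> and
    \<open>(P r, P r * G r)\<close>.\<close>
  moreover have "A u * v - A v * u = (b - a) * (l * P r * (G r - Gl r))"
    unfolding a(1) b(1) by (subst a(2), subst b(2)) (simp add: algebra_simps)
  moreover have "0 \<le> (b - a) * (l * P r * (G r - Gl r))"
    using ab l left_bounds(2)[of r] mu.cdf_nonneg[of r] by (intro mult_nonneg_nonneg) auto
  ultimately show ?thesis
    by linarith
qed

lemma aux_fun_bounds:
  assumes u: "0 < u" "u < 1"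
  shows "u \<le> A u" "A u \<le> 1"
proof -
  define r where "r = real_quantile F u"
  have t: "u \<le> F r"
    using lam.real_quantile_le_iff[OF u, of r] by (simp add: r_def)
  show "A u \<le> 1"
    using aux_fun_upper(1)[OF u t] mu.cdf_bounded_prob[of r] by simp
  have "u \<le> A u * G r"
    by (rule aux_fun_upper(2)[OF u t])
  also have "\<dots> \<le> A u"
    using nu.cdf_bounded_prob[of r] aux_fun_nonneg[OF u] by (rule mult_left_le)
  finally show "u \<le> A u" .
qed

lemma aux_fun_0_1: "A 0 = 0" "A 1 = 1"
  by (simp_all add: aux_fun_def aux_fun_im_def)

text \<open>On the unit interval \<open>f u + u\<close> is \<open>A u\<close>, and for positive
  \<open>u\<close> the ratio \<open>f u / u\<close> is \<open>A u / u - 1\<close>, so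
  \<open>aux_fun_mono_ratio\<close> gives (G2) and (G3) in the interior. The ends, where
  \<open>A\<close> is set by convention, are covered by \<open>u <= A u <= 1\<close>.\<close>

lemma rmm_generator_aux_fun:
  assumes f: "\<And>u. u \<in> {0..1} \<Longrightarrow> f u = A u - u"
  shows "rmm_generator f"
  unfolding rmm_generator_def
proof (intro conjI)
  have bounds: "u \<le> A u \<and> A u \<le> 1" if u: "u \<in> {0..1}" for u
  proof -
    consider "u = 0" | "u = 1" | "0 < u" "u < 1"
      using u by force
    then show ?thesis
      by cases (simp_all add: aux_fun_0_1 aux_fun_bounds)
  qed
  show "f \<in> {0..1} \<rightarrow> {0..1}"
    using bounds by (force simp: f)
  show "f 0 = 0" "f 1 = 0"
    by (simp_all add: f aux_fun_0_1)
  have mono: "A u \<le> A v \<and> A v * u \<le> A u * v" if "0 < u" "u \<le> v" "v \<le> 1" for u v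
  proof -
    consider "u = v" | "u < v" "v = 1" | "u < v" "v < 1"
      using \<open>u \<le> v\<close> \<open>v \<le> 1\<close> by linarith
    then show ?thesis
    proof cases
      case 2
      then show ?thesis
        using bounds[of u] \<open>0 < u\<close> by (simp add: aux_fun_0_1)
    next
      case 3
      then show ?thesis
        using aux_fun_mono_ratio \<open>0 < u\<close> by simp
    qed simp
  qed
  show "mono_on {0..1} (\<lambda>u. f u + u)"
  proof (rule mono_onI)
    fix u v :: real assume "u \<in> {0..1}" "v \<in> {0..1}" "u \<le> v"
    then show "f u + u \<le> f v + v"
      using mono[of u v] bounds[of v] by (cases "u = 0") (auto simp: f aux_fun_0_1)
  qed
  show "antimono_on {0<..1} (\<lambda>u. f u / u)"
  proof (rule monotone_onI)
    fix u v :: real assume *: "u \<in> {0<..1}" "v \<in> {0<..1}" "u \<le> v"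
    then have "A v / v \<le> A u / u"
      using mono[of u v] by (simp add: field_simps)
    then show "f v / v \<le> f u / u"
      using * by (simp add: f diff_divide_distrib)
  qed
qed

text \<open>For \<open>F x < 1\<close> the upper and lower bounds with \<open>t = x\<close> meet. At
  \<open>F x = 0\<close> the convention \<open>A 0 = 0\<close> loses \<open>P x\<close>, hence the
  positivity.\<close>

lemma aux_fun_cdf:
  assumes "0 < F x"
  shows "A (F x) = P x"
proof (cases "F x = 1")
  case True
  then have "P x = 1"
    using mu.cdf_bounded_prob[of x] nu.cdf_bounded_prob[of x] mu.cdf_nonneg[of x]
      mult_left_le[of "G x" "P x"] by (simp add: cdf_eq_mult)
  then show ?thesis
    using True by (simp add: aux_fun_0_1)
next
  case False
  then have "F x < 1"
    using lam.cdf_bounded_prob[of x] by simp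
  then show ?thesis
    using aux_fun_upper(1)[of "F x" x] aux_fun_lower(1)[of "F x" x] assms by simp
qed

end

section \<open>Maxima of independent random variables\<close>

context prob_space
begin

lemma dist_fun_eq:
  assumes "X \<in> borel_measurable M"
  shows "dist_fun M X x = prob {\<omega> \<in> space M. X \<omega> \<le> x}"
  using assms by (auto simp: dist_fun_def cdf_def measure_distr intro!: arg_cong[where f = prob])

text \<open>Choosing \<open>UNIV\<close> for one set drops that variable, so the product formula for
  two variables is included.\<close>

lemma prob_indep_vars3:
  assumes "indep_vars (\<lambda>_. borel) (\<lambda>i. [X, Y, Z] ! i) {..<3}"
    and "A \<in> sets borel" "B \<in> sets borel" "C \<in> sets borel"
  shows "prob {\<omega> \<in> space M. X \<omega> \<in> A \<and> Y \<omega> \<in> B \<and> Z \<omega> \<in> C} =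
    prob {\<omega> \<in> space M. X \<omega> \<in> A} * prob {\<omega> \<in> space M. Y \<omega> \<in> B} * prob {\<omega> \<in> space M. Z \<omega> \<in> C}"
proof -
  have three: "{..<3} = {0, 1, 2::nat}"
    by auto
  have "prob (\<Inter>i\<in>{..<3::nat}. ([X, Y, Z] ! i) -` ([A, B, C] ! i) \<inter> space M) =
      (\<Prod>i\<in>{..<3::nat}. prob (([X, Y, Z] ! i) -` ([A, B, C] ! i) \<inter> space M))"
    using assms by (intro indep_varsD[OF assms(1)]) (auto simp: three)
  moreover have "(\<Inter>i\<in>{..<3::nat}. ([X, Y, Z] ! i) -` ([A, B, C] ! i) \<inter> space M) =
      {\<omega> \<in> space M. X \<omega> \<in> A \<and> Y \<omega> \<in> B \<and> Z \<omega> \<in> C}"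
    by (auto simp: three)
  ultimately show ?thesis
    by (simp add: three vimage_def Int_def conj_commute mult.assoc)
qed

lemma dist_fun_bounds:
  assumes "X \<in> borel_measurable M"
  shows "0 \<le> dist_fun M X x" "dist_fun M X x \<le> 1"
  by (simp_all add: dist_fun_eq[OF assms])

lemma indep_max_dist_fun:
  assumes "X \<in> borel_measurable M" "Y \<in> borel_measurable M" "Z \<in> borel_measurable M"
    and ind: "indep_vars (\<lambda>_. borel) (\<lambda>i. [X, Y, Z] ! i) {..<3}"
  shows "dist_fun M (\<lambda>\<omega>. max (X \<omega>) (Z \<omega>)) x = dist_fun M X x * dist_fun M Z x"
    and "dist_fun M (\<lambda>\<omega>. max (Y \<omega>) (Z \<omega>)) x = dist_fun M Y x * dist_fun M Z x"
  using prob_indep_vars3[OF ind, of "{..x}" UNIV "{..x}"]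
    prob_indep_vars3[OF ind, of UNIV "{..x}" "{..x}"] assms
  by (simp_all add: dist_fun_eq prob_space)

text \<open>Joint independence of \<open>(X, Y)\<close> and \<open>(Z1, Z2)\<close> is not assumed. It suffices that the events
  \<open>Z1 \<le> x\<close> and \<open>Z2 \<le> y\<close> are disjoint or cover the space, up to a null set: in the latter case
  inclusion-exclusion only involves one of \<open>Z1\<close>, \<open>Z2\<close> at a time.\<close>

lemma joint_dist_fun_max:
  assumes [measurable]: "X \<in> borel_measurable M" "Y \<in> borel_measurable M"
      "Z1 \<in> borel_measurable M" "Z2 \<in> borel_measurable M"
    and ind1: "indep_vars (\<lambda>_. borel) (\<lambda>i. [X, Y, Z1] ! i) {..<3}"
    and ind2: "indep_vars (\<lambda>_. borel) (\<lambda>i. [X, Y, Z2] ! i) {..<3}"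
    and cm: "countermonotonic M Z1 Z2"
  shows "joint_dist_fun M (\<lambda>\<omega>. max (X \<omega>) (Z1 \<omega>)) (\<lambda>\<omega>. max (Y \<omega>) (Z2 \<omega>)) x y =
    dist_fun M X x * dist_fun M Y y * max 0 (dist_fun M Z1 x + dist_fun M Z2 y - 1)"
proof -
  define E where "E = {\<omega> \<in> space M. X \<omega> \<le> x \<and> Y \<omega> \<le> y}"
  define S where "S = {\<omega> \<in> space M. Z1 \<omega> \<le> x}"
  define T where "T = {\<omega> \<in> space M. Z2 \<omega> \<le> y}"
  have [measurable]: "E \<in> sets M" "S \<in> sets M" "T \<in> sets M"
    by (auto simp: E_def S_def T_def)
  have ST: "prob (S \<inter> T) = max 0 (prob S + prob T - 1)"
    using cm by (auto simp: countermonotonic_def joint_dist_fun_def dist_fun_eq S_def T_def Int_def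
        conj_commute conj_left_commute)
  have goal: "joint_dist_fun M (\<lambda>\<omega>. max (X \<omega>) (Z1 \<omega>)) (\<lambda>\<omega>. max (Y \<omega>) (Z2 \<omega>)) x y =
      prob (E \<inter> S \<inter> T)"
    by (auto simp: joint_dist_fun_def E_def S_def T_def intro!: arg_cong[where f = prob])
  have E: "prob E = dist_fun M X x * dist_fun M Y y"
    using prob_indep_vars3[OF ind1, of "{..x}" "{..y}" UNIV]
    by (simp add: E_def dist_fun_eq prob_space)
  have "E \<inter> S = {\<omega> \<in> space M. X \<omega> \<in> {..x} \<and> Y \<omega> \<in> {..y} \<and> Z1 \<omega> \<in> {..x}}"
    "E \<inter> T = {\<omega> \<in> space M. X \<omega> \<in> {..x} \<and> Y \<omega> \<in> {..y} \<and> Z2 \<omega> \<in> {..y}}"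
    by (auto simp: E_def S_def T_def)
  then have ES: "prob (E \<inter> S) = prob E * prob S" and ET: "prob (E \<inter> T) = prob E * prob T"
    using prob_indep_vars3[OF ind1, of "{..x}" "{..y}" "{..x}"]
      prob_indep_vars3[OF ind2, of "{..x}" "{..y}" "{..y}"]
    by (simp_all add: E dist_fun_eq S_def T_def)
  have "prob (E \<inter> S \<inter> T) = prob E * prob (S \<inter> T)"
  proof (cases "prob S + prob T \<le> 1")
    case True
    then have "prob (S \<inter> T) = 0"
      using ST by simp
    moreover have "prob (E \<inter> S \<inter> T) \<le> prob (S \<inter> T)"
      by (intro finite_measure_mono) auto
    ultimately show ?thesis
      by (simp add: measure_le_0_iff)
  next
    case False
    then have "prob (S \<inter> T) = prob S + prob T - 1"
      using ST by simp
    moreover have "prob (S \<union> T) = prob S + prob T - prob (S \<inter> T)"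
      by (rule measure_Un3) (auto simp: fmeasurable_eq_sets)
    ultimately have "prob (S \<union> T) = 1"
      by simp
    then have "AE \<omega> in M. \<omega> \<in> S \<union> T"
      by (subst (asm) prob_eq_1) auto
    then have "prob ((E \<inter> S) \<union> (E \<inter> T)) = prob E"
      by (intro finite_measure_eq_AE) auto
    moreover have "prob ((E \<inter> S) \<union> (E \<inter> T)) =
        prob (E \<inter> S) + prob (E \<inter> T) - prob ((E \<inter> S) \<inter> (E \<inter> T))"
      by (rule measure_Un3) (auto simp: fmeasurable_eq_sets)
    moreover have "(E \<inter> S) \<inter> (E \<inter> T) = E \<inter> S \<inter> T"
      by auto
    ultimately have "prob (E \<inter> S \<inter> T) = prob E * (prob S + prob T - 1)"
      by (simp add: ES ET algebra_simps)
    then show ?thesis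
      by (simp add: \<open>prob (S \<inter> T) = prob S + prob T - 1\<close>)
  qed
  then show ?thesis
    unfolding goal E ST by (simp add: dist_fun_eq S_def T_def)
qed

lemma cdf_product_dist_fun:
  assumes "X \<in> borel_measurable M" "Z \<in> borel_measurable M" "U \<in> borel_measurable M"
    and "\<And>x. dist_fun M U x = dist_fun M X x * dist_fun M Z x"
  shows "cdf_product (distr M borel X) (distr M borel Z) (distr M borel U)"
  using assms
  by (auto simp: cdf_product_def cdf_product_axioms_def dist_fun_def)

end

section \<open>The copula of the pair of maxima\<close>

theorem theorem5:
  fixes M :: "'a measure"
    and X Y Z1 Z2 U V :: "'a \<Rightarrow> real"
    and f g :: "real \<Rightarrow> real"
  assumes "prob_space M"
    and "X \<in> borel_measurable M" "Y \<in> borel_measurable M"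
    and "Z1 \<in> borel_measurable M" "Z2 \<in> borel_measurable M"
    and "prob_space.indep_vars M (\<lambda>_. borel) (\<lambda>i. [X, Y, Z1] ! i) {..<3}"
    and "prob_space.indep_vars M (\<lambda>_. borel) (\<lambda>i. [X, Y, Z2] ! i) {..<3}"
    and "countermonotonic M Z1 Z2"
    and "U = (\<lambda>\<omega>. max (X \<omega>) (Z1 \<omega>))"
    and "V = (\<lambda>\<omega>. max (Y \<omega>) (Z2 \<omega>))"
    and "\<And>u. u \<in> {0..1} \<Longrightarrow> f u = aux_fun (dist_fun M X) (dist_fun M U) u - u"
    and "\<And>v. v \<in> {0..1} \<Longrightarrow> g v = aux_fun (dist_fun M Y) (dist_fun M V) v - v"
  shows "rmm_generator f \<and> rmm_generator g \<and> copula_of M U V (rmm_copula f g)"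
proof -
  interpret prob_space M by fact
  note meas [measurable] = assms(2-5) and ind = assms(6,7) and cm = assms(8)
    and U = assms(9) and V = assms(10)
  have FU: "dist_fun M U x = dist_fun M X x * dist_fun M Z1 x"
    and FV: "dist_fun M V x = dist_fun M Y x * dist_fun M Z2 x" for x
    unfolding U V
    by (rule indep_max_dist_fun(1)[OF meas(1-3) ind(1)]
        indep_max_dist_fun(2)[OF meas(1,2,4) ind(2)])+
  have [measurable]: "U \<in> borel_measurable M" "V \<in> borel_measurable M"
    unfolding U V by auto
  interpret u: cdf_product "distr M borel X" "distr M borel Z1" "distr M borel U"
    by (rule cdf_product_dist_fun) (auto simp: FU)
  interpret v: cdf_product "distr M borel Y" "distr M borel Z2" "distr M borel V"
    by (rule cdf_product_dist_fun) (auto simp: FV)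
  have f: "rmm_generator f" and g: "rmm_generator g"
    using assms(11,12) unfolding dist_fun_def
    by (auto intro: u.rmm_generator_aux_fun v.rmm_generator_aux_fun)
  have "joint_dist_fun M U V x y = rmm_copula f g (dist_fun M U x) (dist_fun M V y)" for x y
  proof -
    define p a q b where "p = dist_fun M X x" and "a = dist_fun M Z1 x"
      and "q = dist_fun M Y y" and "b = dist_fun M Z2 y"
    have nonneg: "0 \<le> p" "0 \<le> a" "0 \<le> q" "0 \<le> b"
      by (simp_all add: p_def a_def q_def b_def dist_fun_bounds)
    have joint: "joint_dist_fun M U V x y = p * q * max 0 (a + b - 1)"
      unfolding U V p_def q_def a_def b_def by (rule joint_dist_fun_max[OF meas ind cm])
    have u: "dist_fun M U x = p * a" and v: "dist_fun M V y = q * b"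
      by (simp_all add: FU FV p_def a_def q_def b_def)
    have range: "dist_fun M U x \<in> {0..1}" "dist_fun M V y \<in> {0..1}"
      by (simp_all add: dist_fun_bounds)
    show ?thesis
    \<comment> \<open>\<open>f (p * a)\<close> recovers \<open>p\<close> only if
      \<open>p * a\<close> is positive, and likewise for \<open>g\<close>. If a marginal vanishes,
      both sides are 0; for \<open>a = 0\<close> with \<open>p\<close> positive this uses
      \<open>b <= 1\<close>, so that the maximum is 0.\<close>
    proof (cases "0 < p * a \<and> 0 < q * b")
      case True
      then have fg: "f (p * a) = p - p * a" "g (q * b) = q - q * b"
        using assms(11)[OF range(1)] assms(12)[OF range(2)] u.aux_fun_cdf[of x] v.aux_fun_cdf[of y] u v
        by (simp_all add: dist_fun_def p_def q_def)
      have "p * a * (q * b) - f (p * a) * g (q * b) = p * q * (a + b - 1)"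
        unfolding fg by (simp add: algebra_simps)
      then show ?thesis
        unfolding joint u v rmm_copula_def
        using nonneg by (simp add: max_mult_distrib_left)
    next
      case False
      then consider "p * a = 0" | "q * b = 0"
        using nonneg by (metis mult_nonneg_nonneg order_le_less)
      then have "p * q * max 0 (a + b - 1) = 0 \<and> rmm_copula f g (p * a) (q * b) = 0"
      proof cases
        case 1
        moreover have "b \<le> 1"
          by (simp add: b_def dist_fun_bounds)
        ultimately show ?thesis
          using rmm_generatorD(2)[OF f] by (auto simp: rmm_copula_def)
      next
        case 2
        moreover have "a \<le> 1"
          by (simp add: a_def dist_fun_bounds)
        ultimately show ?thesis
          using rmm_generatorD(2)[OF g] by (auto simp: rmm_copula_def)
      qed
      then show ?thesis
        unfolding joint u v by simp
    qed
  qed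
  then show ?thesis
    using f g copula_rmm_copula[OF f g] by (simp add: copula_of_def)
qed

end
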